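(* Let $(S,\mathcal F,\mathcal S,\mathrm E,P)$ be a quintuplet satisfying conditions C1--C5 and axioms A1, A2, A3 (as listed in the context), where $S$ is a path connected topological space. Let $n\ge 1$ and let $X_1,\ldots,X_n$ be continuous functions $S\to\mathbb R$ belonging to $\mathcal S$. Then there exist points $t_1,\ldots,t_n$ in $S$ and non-negative numbers $\lambda_1,\ldots,\lambda_n$ with $\sum_{i=1}^n\lambda_i=1$ such that $$\mathrm E X_k=\sum_{i=1}^n\lambda_iX_k(t_i),\qquad k=1,\ldots,n.$$
   Context: Setting. $S$ is a nonempty set (here also a topological space), $\mathcal F$ is an algebra of subsets of $S$ (it contains $S$ and is closed under finite set operations; it may be a sigma-algebra), $\mathcal S$ is a family of functions $X:S\to\mathbb R$ (not assumed bounded), $\mathrm E:\mathcal S\to\mathbb R$ is a functional, and $P$ is the set function $P(B)=\mathrm E(I_B)$, $B\in\mathcal F$, where $I_B$ is the indicator function of $B$. Notation such as $P(X=0)$ means $P(\{s\in S: X(s)=0\})$, and $I_{X\in J}$ is the indicator of $\{s\in S: X(s)\in J\}$. "Interval" means any interval of $\mathbb R$, bounded or unbounded. $S$ is path connected if for any $a,b\in S$ there is a continuous $f:[0,1]\to S$ with $f(0)=a$, $f(1)=b$. Conditions: C1: if $X_1,X_2\in\mathcal S$ then $aX_1+bX_2\in\mathcal S$ for all $a,b\in\mathbb R$. C2: for $B\in\mathcal F$, $I_B\in\mathcal S$. C3: for $X\in\mathcal S$ and any interval $J$, the set $\{s\in S: X(s)\in J\}$ is in $\mathcal F$. C4: for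 $X\in\mathcal S$ with $X(s)\ge 0$ for all $s\in S$, $X\cdot I_{X\in J}\in\mathcal S$ for any interval $J$. C5: if $X\in\mathcal S$, $N\in\mathcal F$ and $P(N)=0$, then $X\cdot I_N\in\mathcal S$ and $\mathrm E(X\cdot I_N)=0$. Axioms: A1: $\mathrm E c=c$ for any constant $c$. A2: $\mathrm E\left(\sum_{i=1}^m\alpha_iX_i\right)=\sum_{i=1}^m\alpha_i\mathrm E(X_i)$ for $\alpha_i\in\mathbb R$, $X_i\in\mathcal S$. A3: for $X\in\mathcal S$, if $\mathrm E X=0$ then either $P(X=0)=1$ or there exist $s_1,s_2\in S$ such that $X(s_1)X(s_2)<0$ (inclusive "or"). *)

theory Defs
  imports "HOL-Analysis.Analysis"
begin

text \<open>
  The nonempty set S is the whole type \<open>'a\<close>, so that functions on S are exactly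
  the functions of type \<open>'a \<Rightarrow> real\<close>. The values of \<open>E\<close> outside \<open>\<X>\<close> and of
  \<open>P\<close> outside \<open>\<F>\<close> are irrelevant. The intervals of \<open>is_interval\<close> include the
  degenerate ones (singletons and the empty set) and the unbounded ones.
\<close>

locale expectation_quintuplet =
  fixes \<F> :: "'a set set"
    and \<X> :: "('a \<Rightarrow> real) set"
    and E :: "('a \<Rightarrow> real) \<Rightarrow> real"
    and P :: "'a set \<Rightarrow> real"
  assumes algebra: "algebra UNIV \<F>"
    and P_eq: "B \<in> \<F> \<Longrightarrow> P B = E (indicat_real B)"
    and C1: "X1 \<in> \<X> \<Longrightarrow> X2 \<in> \<X> \<Longrightarrow> (\<lambda>s. a * X1 s + b * X2 s) \<in> \<X>"
    and C2: "B \<in> \<F> \<Longrightarrow> indicat_real B \<in> \<X>"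
    and C3: "X \<in> \<X> \<Longrightarrow> is_interval J \<Longrightarrow> {s. X s \<in> J} \<in> \<F>"
    and C4: "X \<in> \<X> \<Longrightarrow> (\<And>s. X s \<ge> 0) \<Longrightarrow> is_interval J \<Longrightarrow>
               (\<lambda>s. X s * indicat_real {s. X s \<in> J} s) \<in> \<X>"
    and C5: "X \<in> \<X> \<Longrightarrow> N \<in> \<F> \<Longrightarrow> P N = 0 \<Longrightarrow>
               (\<lambda>s. X s * indicat_real N s) \<in> \<X> \<and> E (\<lambda>s. X s * indicat_real N s) = 0"
    and A1: "E (\<lambda>s. c) = c"
    and A2: "(\<And>i. i \<in> {1..m} \<Longrightarrow> Y i \<in> \<X>) \<Longrightarrow>
               E (\<lambda>s. \<Sum>i=1..m::nat. \<alpha> i * Y i s) = (\<Sum>i=1..m. \<alpha> i * E (Y i))"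
    and A3: "X \<in> \<X> \<Longrightarrow> E X = 0 \<Longrightarrow>
               P {s. X s = 0} = 1 \<or> (\<exists>s1 s2. X s1 * X s2 < 0)"

end

theory Submission
  imports Defs
begin

section \<open>Separation of a convex set from the origin\<close>

text \<open>
  The library separates convex sets in a type of class \<open>euclidean_space\<close>, whose dimension cannot
  vary with \<open>K\<close>. By induction, a functional on the slice \<open>x j = 0\<close> is extended: the lower bounds
  that the points with \<open>x j > 0\<close> impose on the new coefficient lie below the upper bounds from
  \<open>x j < 0\<close>, since a convex combination of two such points is in the slice.
\<close>

lemma proper_separation:
  fixes C :: "('k \<Rightarrow> real) set"
  assumes "finite K" and "C \<noteq> {}"
    and "\<And>x y u. x \<in> C \<Longrightarrow> y \<in> C \<Longrightarrow> 0 \<le> u \<Longrightarrow> u \<le> 1 \<Longrightarrow> (\<lambda>k. (1 - u) * x k + u * y k) \<in> C"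
    and "\<And>x. x \<in> C \<Longrightarrow> \<exists>k\<in>K. x k \<noteq> 0"
  shows "\<exists>a. (\<forall>x\<in>C. 0 \<le> (\<Sum>k\<in>K. a k * x k)) \<and> (\<exists>x\<in>C. 0 < (\<Sum>k\<in>K. a k * x k))"
  using assms
proof (induction K arbitrary: C rule: finite_induct)
  case empty
  then show ?case by auto
next
  case (insert j K C)
  note conv = insert.prems(2) and nz = insert.prems(3)
  have sum_delta: "(\<Sum>k\<in>insert j K. (if k = j then c else 0) * x k) = c * x j" for c and x :: "'k \<Rightarrow> real"
    using insert.hyps by (simp add: if_distrib[where f="\<lambda>z. z * _"] cong: if_cong)
  show ?case
  proof (cases "(\<exists>p\<in>C. p j > 0) \<and> (\<exists>q\<in>C. q j < 0)")
    case False
    \<comment> \<open>If the coordinate \<open>j\<close> does not take both signs on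
      \<open>C\<close>, then it or its negative already separates, unless it vanishes on all of
      \<open>C\<close>; in that case the induction hypothesis applies to \<open>C\<close>
      itself.\<close>
    then consider "\<forall>x\<in>C. x j = 0" | "\<forall>x\<in>C. x j \<ge> 0" "\<exists>x\<in>C. x j > 0"
      | "\<forall>x\<in>C. x j \<le> 0" "\<exists>x\<in>C. x j < 0"
      by (meson linorder_neqE_linordered_idom not_le)
    then show ?thesis
    proof cases
      case 1
      have "\<exists>a. (\<forall>x\<in>C. 0 \<le> (\<Sum>k\<in>K. a k * x k)) \<and> (\<exists>x\<in>C. 0 < (\<Sum>k\<in>K. a k * x k))"
        using 1 nz insert.prems(1) conv by (intro insert.IH) auto
      then obtain a where "\<forall>x\<in>C. 0 \<le> (\<Sum>k\<in>K. a k * x k)" "\<exists>x\<in>C. 0 < (\<Sum>k\<in>K. a k * x k)"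
        by blast
      moreover have "(\<Sum>k\<in>insert j K. a k * x k) = (\<Sum>k\<in>K. a k * x k)" if "x \<in> C" for x
      proof -
        have "x j = 0" using 1 that by blast
        then show ?thesis using insert.hyps by simp
      qed
      ultimately show ?thesis
        by (intro exI[of _ a]) simp
    next
      case 2
      then show ?thesis
        using sum_delta[of 1] by (intro exI[of _ "\<lambda>k. if k = j then 1 else 0"]) auto
    next
      case 3
      then show ?thesis
        using sum_delta[of "-1"] by (intro exI[of _ "\<lambda>k. if k = j then -1 else 0"]) auto
    qed
  next
    case True
    define C0 where "C0 = {x \<in> C. x j = 0}"
    \<comment> \<open>The weight \<open>u\<close> solves \<open>(1 - u) * p j + u * q j = 0\<close>,
      which puts the combination into the slice.\<close>
    have mix: "(\<lambda>k. (1 - p j / (p j - q j)) * p k + p j / (p j - q j) * q k) \<in> C0"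
      if "p \<in> C" "q \<in> C" "p j > 0" "q j < 0" for p q
    proof -
      have "(1 - p j / (p j - q j)) * p j + p j / (p j - q j) * q j = 0"
        using that by (simp add: field_simps)
      moreover have "(\<lambda>k. (1 - p j / (p j - q j)) * p k + p j / (p j - q j) * q k) \<in> C"
        by (rule conv[OF that(1,2)]) (use that in \<open>simp_all add: divide_simps\<close>)
      ultimately show ?thesis
        by (simp add: C0_def)
    qed
    have "\<exists>a. (\<forall>x\<in>C0. 0 \<le> (\<Sum>k\<in>K. a k * x k)) \<and> (\<exists>x\<in>C0. 0 < (\<Sum>k\<in>K. a k * x k))"
    proof (rule insert.IH)
      show "C0 \<noteq> {}" using True mix by blast
      show "(\<lambda>k. (1 - u) * x k + u * y k) \<in> C0" if "x \<in> C0" "y \<in> C0" "0 \<le> u" "u \<le> 1" for x y u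
        using that conv by (auto simp: C0_def)
      show "\<exists>k\<in>K. x k \<noteq> 0" if "x \<in> C0" for x
        using that nz[of x] by (auto simp: C0_def)
    qed
    then obtain a where a: "\<And>x. x \<in> C0 \<Longrightarrow> 0 \<le> (\<Sum>k\<in>K. a k * x k)"
      and a_pos: "\<exists>x\<in>C0. 0 < (\<Sum>k\<in>K. a k * x k)"
      by blast
    define A where "A x = (\<Sum>k\<in>K. a k * x k)" for x
    have cross: "- A p / p j \<le> A q / (- q j)"
      if pq: "p \<in> C" "p j > 0" "q \<in> C" "q j < 0" for p q
    proof -
      define u where "u = p j / (p j - q j)"
      have "0 \<le> A (\<lambda>k. (1 - u) * p k + u * q k)"
        using a[OF mix[of p q]] pq unfolding A_def u_def by simp
      also have "\<dots> = (1 - u) * A p + u * A q"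
        unfolding A_def by (simp add: algebra_simps sum.distrib sum_distrib_left sum_subtractf)
      finally have "0 \<le> (p j - q j) * ((1 - u) * A p + u * A q)"
        using pq by simp
      also have "\<dots> = (p j - q j) * A p + (p j - q j) * u * (A q - A p)"
        by (simp add: algebra_simps)
      also have "(p j - q j) * u = p j"
        using pq by (simp add: u_def)
      also have "(p j - q j) * A p + p j * (A q - A p) = - q j * A p + p j * A q"
        by (simp add: algebra_simps)
      finally show ?thesis
        using pq by (simp add: field_simps)
    qed
    \<comment> \<open>By \<open>cross\<close>, a single point \<open>q0\<close> with
      \<open>q0 j < 0\<close> bounds all these quotients, so the supremum is a real number between
      the lower and the upper bounds.\<close>
    define b where "b = (SUP p\<in>{p \<in> C. p j > 0}. - A p / p j)"
    obtain p0 q0 where pq0: "p0 \<in> C" "p0 j > 0" "q0 \<in> C" "q0 j < 0"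
      using True by blast
    have b_ge: "- A p / p j \<le> b" if "p \<in> C" "p j > 0" for p
      unfolding b_def using that pq0 cross
      by (intro cSUP_upper bdd_aboveI2[where M="A q0 / (- q0 j)"]) blast+
    have b_le: "b \<le> A q / (- q j)" if "q \<in> C" "q j < 0" for q
      unfolding b_def using that pq0 cross by (intro cSUP_least) blast+
    have nonneg: "0 \<le> b * x j + A x" if "x \<in> C" for x
    proof (cases "x j" "0::real" rule: linorder_cases)
      case less
      then show ?thesis using b_le[OF that less] by (simp add: field_simps)
    next
      case equal
      then show ?thesis using a[of x] that by (simp add: A_def C0_def)
    next
      case greater
      then show ?thesis using b_ge[OF that greater] by (simp add: field_simps)
    qed
    have eq: "(\<Sum>k\<in>insert j K. (a(j := b)) k * x k) = b * x j + A x" for x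
    proof -
      have "(\<Sum>k\<in>K. (a(j := b)) k * x k) = A x"
        unfolding A_def using insert.hyps by (intro sum.cong) auto
      with insert.hyps show ?thesis by simp
    qed
    \<comment> \<open>Strict positivity is inherited from the slice, where the new coefficient
      \<open>b\<close> is multiplied by zero.\<close>
    obtain x where "x \<in> C" "x j = 0" "0 < A x"
      using a_pos by (auto simp: A_def C0_def)
    then have "\<exists>x\<in>C. 0 < b * x j + A x"
      by (intro bexI[of _ x]) simp_all
    with nonneg show ?thesis
      by (intro exI[of _ "a(j := b)"]) (simp only: eq, blast)
  qed
qed

section \<open>Linear dependence and dual functionals\<close>

text \<open>Gaussian elimination: a pivot \<open>y r\<close> with \<open>y r j \<noteq> 0\<close>
  clears the coordinate \<open>j\<close> from the other vectors. This costs one vector and one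
  coordinate, so the inequality of cardinalities persists.\<close>

lemma linear_dependence:
  fixes y :: "'t \<Rightarrow> 'k \<Rightarrow> real"
  assumes "finite K" and "finite T" and "card K < card T"
  shows "\<exists>c. (\<exists>t\<in>T. c t \<noteq> 0) \<and> (\<forall>k\<in>K. (\<Sum>t\<in>T. c t * y t k) = 0)"
  using assms
proof (induction K arbitrary: T y rule: finite_induct)
  case empty
  then have "T \<noteq> {}" by auto
  then show ?case by (intro exI[of _ "\<lambda>_. 1"]) auto
next
  case (insert j K T y)
  show ?case
  proof (cases "\<forall>t\<in>T. y t j = 0")
    case True
    with insert.IH[of T y] insert.prems insert.hyps show ?thesis by auto
  next
    case False
    then obtain r where r: "r \<in> T" "y r j \<noteq> 0" by blast
    define z where "z t k = y t k - y t j / y r j * y r k" for t k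
    have "card K < card (T - {r})"
      using insert.prems insert.hyps r by simp
    then obtain c where c: "\<exists>t\<in>T - {r}. c t \<noteq> 0"
      "\<And>k. k \<in> K \<Longrightarrow> (\<Sum>t\<in>T - {r}. c t * z t k) = 0"
      using insert.IH[of "T - {r}" z] insert.prems by auto
    \<comment> \<open>The coefficient at the pivot collects the multiples of \<open>y r\<close>
      subtracted in \<open>z\<close>, so that both combinations agree in every coordinate.\<close>
    define d where "d = c(r := - (\<Sum>t\<in>T - {r}. c t * (y t j / y r j)))"
    have d_sum: "(\<Sum>t\<in>T. d t * y t k) = (\<Sum>t\<in>T - {r}. c t * z t k)" for k
    proof -
      have "(\<Sum>t\<in>T. d t * y t k) = d r * y r k + (\<Sum>t\<in>T - {r}. d t * y t k)"
        using r insert.prems by (simp add: sum.remove)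
      also have "(\<Sum>t\<in>T - {r}. d t * y t k) = (\<Sum>t\<in>T - {r}. c t * y t k)"
        by (intro sum.cong) (auto simp: d_def)
      finally show ?thesis
        by (simp add: d_def z_def right_diff_distrib sum_subtractf sum_distrib_right mult.assoc)
    qed
    have "z t j = 0" for t
      using r by (simp add: z_def)
    then have "\<forall>k\<in>insert j K. (\<Sum>t\<in>T. d t * y t k) = 0"
      unfolding d_sum using c(2) by auto
    moreover have "\<exists>t\<in>T. d t \<noteq> 0"
      using c(1) by (auto simp: d_def)
    ultimately show ?thesis by blast
  qed
qed

text \<open>By independence, the affine space of \<open>y r\<close> plus the span of the other
  vectors misses the origin. A separating functional turns out to vanish on the other vectors and to
  be positive at \<open>y r\<close>, where it can be normalised to 1.\<close>

lemma dual_functional: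
  fixes y :: "'t \<Rightarrow> 'k \<Rightarrow> real"
  assumes "finite K" and "finite T" and "r \<in> T"
    and indep: "\<And>c. (\<And>k. k \<in> K \<Longrightarrow> (\<Sum>t\<in>T. c t * y t k) = 0) \<Longrightarrow> \<forall>t\<in>T. c t = 0"
  shows "\<exists>d. \<forall>t\<in>T. (\<Sum>k\<in>K. d k * y t k) = (if t = r then 1 else 0)"
proof -
  define pt where "pt c k = y r k + (\<Sum>t\<in>T - {r}. c t * y t k)" for c k
  define C where "C = range pt"
  have pt_mix: "(\<lambda>k. (1 - u) * pt c k + u * pt c' k) = pt (\<lambda>t. (1 - u) * c t + u * c' t)" for c c' u
    by (rule ext) (simp add: pt_def algebra_simps sum.distrib sum_distrib_left sum_subtractf)
  have "\<exists>a. (\<forall>x\<in>C. 0 \<le> (\<Sum>k\<in>K. a k * x k)) \<and> (\<exists>x\<in>C. 0 < (\<Sum>k\<in>K. a k * x k))"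
  proof (rule proper_separation[OF \<open>finite K\<close>])
    show "C \<noteq> {}" by (simp add: C_def)
    show "(\<lambda>k. (1 - u) * x k + u * x' k) \<in> C" if "x \<in> C" "x' \<in> C" for x x' u
      using that by (auto simp: C_def pt_mix)
    show "\<exists>k\<in>K. x k \<noteq> 0" if "x \<in> C" for x
    proof (rule ccontr)
      assume zero: "\<not> (\<exists>k\<in>K. x k \<noteq> 0)"
      from that obtain c where c: "x = pt c" by (auto simp: C_def)
      \<comment> \<open>A point of \<open>C\<close> that vanishes on \<open>K\<close> is a linear
        relation with coefficient 1 at \<open>r\<close>.\<close>
      have "(\<Sum>t\<in>T. (c(r := 1)) t * y t k) = x k" for k
        using assms(2,3) by (simp add: c pt_def sum.remove[of T r])
      with zero indep[of "c(r := 1)"] assms(3) show False by auto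
    qed
  qed
  then obtain a where a: "\<And>c. 0 \<le> (\<Sum>k\<in>K. a k * pt c k)"
    and a_pos: "\<exists>c. 0 < (\<Sum>k\<in>K. a k * pt c k)"
    by (auto simp: C_def)
  define A where "A t = (\<Sum>k\<in>K. a k * y t k)" for t
  have A_pt: "(\<Sum>k\<in>K. a k * pt c k) = A r + (\<Sum>t\<in>T - {r}. c t * A t)" for c
  proof -
    have "(\<Sum>k\<in>K. a k * (\<Sum>t\<in>T - {r}. c t * y t k)) = (\<Sum>t\<in>T - {r}. c t * A t)"
      unfolding A_def sum_distrib_left by (subst sum.swap) (simp add: mult_ac)
    then show ?thesis
      by (simp add: pt_def A_def distrib_left sum.distrib)
  qed
  \<comment> \<open>The functional is bounded below on an affine space, hence constant there.\<close>
  have A0: "A t = 0" if t: "t \<in> T - {r}" for t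
  proof (rule ccontr)
    assume "A t \<noteq> 0"
    define c where "c = (\<lambda>s. if s = t then - (A r + 1) / A t else 0)"
    have "(\<Sum>s\<in>T - {r}. c s * A s) = - (A r + 1)"
      using t \<open>A t \<noteq> 0\<close> \<open>finite T\<close>
      by (simp add: c_def if_distrib[where f="\<lambda>z. z * _"] cong: if_cong)
    with a[of c] show False by (simp add: A_pt)
  qed
  then have "A r > 0"
    using a_pos by (auto simp: A_pt)
  have "(\<Sum>k\<in>K. a k / A r * y t k) = A t / A r" for t
    by (simp add: A_def sum_divide_distrib)
  with A0 \<open>A r > 0\<close> show ?thesis
    by (intro exI[of _ "\<lambda>k. a k / A r"]) auto
qed

section \<open>Saving one point by connectedness\<close>

text \<open>
  In a representation of minimal size the evaluations at the points of \<open>T\<close> are linearly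
  independent. If there were as many of them as functions, the dual coefficients \<open>\<beta> t\<close> would be
  continuous, and by connectedness the maximum of \<open>\<beta> t s / w t\<close> over \<open>t\<close> would be attained at two
  indices \<open>i\<close> and \<open>j\<close> for some \<open>s\<close>. Exchanging \<open>i\<close> and \<open>j\<close> for \<open>s\<close> then shortens the
  representation.
\<close>

lemma caratheodory_fenchel:
  fixes Y :: "'k \<Rightarrow> 'a::topological_space \<Rightarrow> real"
  assumes conn: "connected (UNIV :: 'a set)"
    and finL: "finite L" and L2: "2 \<le> card L"
    and one: "k0 \<in> L" "\<And>s. Y k0 s = 1"
    and cont: "\<And>k. k \<in> L \<Longrightarrow> continuous_on UNIV (Y k)"
    and rep0: "finite T0" "\<And>t. t \<in> T0 \<Longrightarrow> 0 \<le> w0 t" "\<And>k. k \<in> L \<Longrightarrow> v k = (\<Sum>t\<in>T0. w0 t * Y k t)"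
  shows "\<exists>T w. finite T \<and> card T < card L \<and> (\<forall>t\<in>T. 0 \<le> w t) \<and> (\<forall>k\<in>L. v k = (\<Sum>t\<in>T. w t * Y k t))"
proof -
  \<comment> \<open>The total weight has no clause of its own: the constant function
    \<open>Y k0\<close> makes it one of the equations.\<close>
  define rep where "rep T w \<longleftrightarrow> finite T \<and> (\<forall>t\<in>T. 0 \<le> w t) \<and> (\<forall>k\<in>L. v k = (\<Sum>t\<in>T. w t * Y k t))" for T w
  have "\<exists>m T w. rep T w \<and> card T = m"
    using rep0 unfolding rep_def by blast
  then have "\<exists>m. (\<exists>T w. rep T w \<and> card T = m) \<and> (\<forall>m'<m. \<not> (\<exists>T w. rep T w \<and> card T = m'))"
    using exists_least_iff[of "\<lambda>m. \<exists>T w. rep T w \<and> card T = m"] by blast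
  then obtain T w where rep: "rep T w" and min: "\<And>T' w'. rep T' w' \<Longrightarrow> card T \<le> card T'"
    by (metis not_le)
  have finT: "finite T" using rep by (simp add: rep_def)
  \<comment> \<open>A point of weight zero could be dropped, against minimality. The claim covers
    all weights on \<open>T\<close>, since \<open>indep_pos\<close> applies it to weights other than
    \<open>w\<close>.\<close>
  have pos: "0 < w' t" if "rep T w'" "t \<in> T" for w' t
  proof (rule ccontr)
    assume "\<not> 0 < w' t"
    with that have "w' t = 0" by (auto simp: rep_def intro: antisym)
    with that have "rep (T - {t}) w'"
      by (auto simp: rep_def sum.remove[of T t])
    from min[OF this] card_Diff1_less[OF finT that(2)] show False
      by linarith
  qed
  have indep_pos: False
    if c: "\<And>k. k \<in> L \<Longrightarrow> (\<Sum>t\<in>T. c t * Y k t) = 0" and r0: "r0 \<in> T" "c r0 > 0" for c r0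
  proof -
    \<comment> \<open>\<open>\<theta>\<close> is the largest multiple of \<open>c\<close> that can
      be subtracted from \<open>w\<close> without creating a negative weight; the weight at the
      minimising point becomes zero, against \<open>pos\<close>.\<close>
    define \<theta> where "\<theta> = Min ((\<lambda>t. w t / c t) ` {t\<in>T. c t > 0})"
    have "\<theta> \<in> (\<lambda>t. w t / c t) ` {t\<in>T. c t > 0}"
      unfolding \<theta>_def using finT r0 by (intro Min_in) auto
    then obtain r where r: "r \<in> T" "c r > 0" "\<theta> = w r / c r" by auto
    have le: "\<theta> \<le> w t / c t" if "t \<in> T" "c t > 0" for t
      unfolding \<theta>_def using that finT by (intro Min_le) auto
    have "\<theta> > 0" using r pos[OF rep] by simp
    have "0 \<le> w t - \<theta> * c t" if "t \<in> T" for t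
    proof (cases "c t > 0")
      case True
      then show ?thesis using le[OF that True] by (simp add: field_simps)
    next
      case False
      then have "\<theta> * c t \<le> 0" using \<open>\<theta> > 0\<close> by (simp add: mult_le_0_iff)
      then show ?thesis using pos[OF rep that] by simp
    qed
    moreover have "(\<Sum>t\<in>T. (w t - \<theta> * c t) * Y k t) = v k" if "k \<in> L" for k
    proof -
      have "(\<Sum>t\<in>T. (w t - \<theta> * c t) * Y k t) = (\<Sum>t\<in>T. w t * Y k t) - \<theta> * (\<Sum>t\<in>T. c t * Y k t)"
        by (simp add: left_diff_distrib sum_subtractf sum_distrib_left mult.assoc)
      with c[OF that] rep that show ?thesis by (simp add: rep_def)
    qed
    ultimately have "rep T (\<lambda>t. w t - \<theta> * c t)"
      using finT by (simp add: rep_def)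
    from pos[OF this r(1)] r show False by simp
  qed
  have indep: "\<forall>t\<in>T. c t = 0" if c: "\<And>k. k \<in> L \<Longrightarrow> (\<Sum>t\<in>T. c t * Y k t) = 0" for c
  proof (rule ccontr)
    assume "\<not> (\<forall>t\<in>T. c t = 0)"
    then obtain t where "t \<in> T" "c t > 0 \<or> - c t > 0" by force
    with indep_pos[of c t] indep_pos[of "\<lambda>t. - c t" t] c show False
      by (auto simp: sum_negf)
  qed
  have "card T < card L"
  proof (rule ccontr)
    assume "\<not> card T < card L"
    moreover have "\<not> card L < card T"
      using linear_dependence[OF finL finT, of "\<lambda>t k. Y k t"] indep by auto
    ultimately have cardT: "card T = card L" by simp
    have "\<exists>d. \<forall>t\<in>T. (\<Sum>k\<in>L. d k * Y k t) = (if t = r then 1 else 0)" if "r \<in> T" for r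
      using dual_functional[OF finL finT that, of "\<lambda>t k. Y k t"] indep by blast
    then obtain d where d: "\<And>r t. r \<in> T \<Longrightarrow> t \<in> T \<Longrightarrow> (\<Sum>k\<in>L. d r k * Y k t) = (if t = r then 1 else 0)"
      by metis
    define \<beta> where "\<beta> r s = (\<Sum>k\<in>L. d r k * Y k s)" for r s
    have \<beta>_cont: "continuous_on UNIV (\<beta> r)" for r
      unfolding \<beta>_def by (intro continuous_intros cont)
    have \<beta>_T: "\<beta> r t = (if t = r then 1 else 0)" if "r \<in> T" "t \<in> T" for r t
      using d that by (simp add: \<beta>_def)
    \<comment> \<open>As \<open>card T = card L\<close>, the evaluations at \<open>T\<close> form a
      basis. Any further evaluation, at \<open>s\<close>, depends on them, and \<open>d r\<close>
      reads off its coefficient \<open>\<beta> r s\<close>.\<close>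
    have expand: "Y k s = (\<Sum>t\<in>T. \<beta> t s * Y k t)" if "k \<in> L" for k s
    proof (cases "s \<in> T")
      case True
      have "(\<Sum>t\<in>T. \<beta> t s * Y k t) = (\<Sum>t\<in>T. if s = t then Y k t else 0)"
        using True \<beta>_T by (intro sum.cong) auto
      then show ?thesis using True finT by simp
    next
      case False
      have "card L < card (insert s T)"
        using False finT cardT by simp
      then obtain c where c: "\<exists>t\<in>insert s T. c t \<noteq> 0"
        "\<And>k. k \<in> L \<Longrightarrow> (\<Sum>t\<in>insert s T. c t * Y k t) = 0"
        using linear_dependence[OF finL, of "insert s T" "\<lambda>t k. Y k t"] finT by auto
      have c': "c s * Y k s + (\<Sum>t\<in>T. c t * Y k t) = 0" if "k \<in> L" for k
        using c(2)[OF that] False finT by simp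
      have cs: "c s \<noteq> 0"
      proof
        assume "c s = 0"
        then have "\<forall>t\<in>T. c t = 0" using c' by (intro indep) simp
        with c(1) \<open>c s = 0\<close> show False by auto
      qed
      have ct: "c r = - c s * \<beta> r s" if "r \<in> T" for r
      proof -
        have "(\<Sum>k\<in>L. d r k * (\<Sum>t\<in>T. c t * Y k t)) = (\<Sum>t\<in>T. c t * \<beta> r t)"
          unfolding sum_distrib_left \<beta>_def by (subst sum.swap) (simp add: mult_ac)
        also have "\<dots> = (\<Sum>t\<in>T. if r = t then c t else 0)"
          using that \<beta>_T by (intro sum.cong) auto
        also have "\<dots> = c r" using that finT by simp
        finally have "c s * \<beta> r s + c r = (\<Sum>k\<in>L. d r k * (c s * Y k s + (\<Sum>t\<in>T. c t * Y k t)))"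
          by (simp add: distrib_left sum.distrib \<beta>_def sum_distrib_left mult_ac)
        also have "\<dots> = 0" using c' by simp
        finally show ?thesis by simp
      qed
      have "(\<Sum>t\<in>T. c t * Y k t) = - c s * (\<Sum>t\<in>T. \<beta> t s * Y k t)"
        unfolding sum_distrib_left by (intro sum.cong) (auto simp: ct)
      with c'[OF that] have "c s * (Y k s - (\<Sum>t\<in>T. \<beta> t s * Y k t)) = 0"
        by (simp add: algebra_simps)
      with cs show ?thesis by simp
    qed
    define A where "A i = {s. \<forall>t\<in>T. \<beta> t s / w t \<le> \<beta> i s / w i}" for i
    have A_closed: "closed (A i)" for i
      unfolding A_def divide_inverse Collect_ball_eq
      by (intro closed_INT ballI closed_Collect_le continuous_intros \<beta>_cont)
    have T_ne: "T \<noteq> {}" using cardT L2 by auto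
    then obtain i where i: "i \<in> T" by blast
    have "0 < card (T - {i})"
      using cardT L2 i finT by simp
    then obtain i' where i': "i' \<in> T" "i' \<noteq> i"
      by (auto simp: card_gt_0_iff)
    have A_self: "r \<in> A r" if "r \<in> T" for r
      using that \<beta>_T pos[OF rep] by (auto simp: A_def less_imp_le)
    have A_cover: "\<exists>r\<in>T. s \<in> A r" for s
    proof -
      have "Max ((\<lambda>t. \<beta> t s / w t) ` T) \<in> (\<lambda>t. \<beta> t s / w t) ` T"
        using finT T_ne by (intro Max_in) auto
      then obtain r where "r \<in> T" "Max ((\<lambda>t. \<beta> t s / w t) ` T) = \<beta> r s / w r" by auto
      moreover have "\<beta> t s / w t \<le> Max ((\<lambda>t. \<beta> t s / w t) ` T)" if "t \<in> T" for t
        using that finT by (intro Max_ge) auto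
      ultimately show ?thesis by (auto simp: A_def)
    qed
    \<comment> \<open>The closed sets \<open>A r\<close> with \<open>r \<in> T\<close> cover the
      space, and each contains its own \<open>r\<close>. Hence \<open>A i\<close> and the union of
      the others are nonempty and closed, and connectedness makes them meet.\<close>
    have "A i \<inter> (\<Union>r\<in>T - {i}. A r) \<noteq> {}"
    proof
      assume disj: "A i \<inter> (\<Union>r\<in>T - {i}. A r) = {}"
      have "closed (\<Union>r\<in>T - {i}. A r)"
        using finT A_closed by (intro closed_UN) auto
      moreover have "UNIV \<subseteq> A i \<union> (\<Union>r\<in>T - {i}. A r)"
        using A_cover by blast
      ultimately show False
        using conn disj A_closed[of i] A_self i i' unfolding connected_closed by blast
    qed
    then obtain s j where s: "s \<in> A i" "s \<in> A j" and j: "j \<in> T" "j \<noteq> i" by blast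
    define \<mu> where "\<mu> = \<beta> i s / w i"
    have \<mu>_j: "\<mu> = \<beta> j s / w j"
      using s i j unfolding A_def \<mu>_def by (intro antisym) auto
    have \<mu>_ge: "\<beta> t s \<le> \<mu> * w t" if "t \<in> T" for t
    proof -
      have "\<beta> t s / w t \<le> \<mu>"
        using s(1) that by (simp add: A_def \<mu>_def)
      with pos[OF rep that] show ?thesis by (simp add: pos_divide_le_eq)
    qed
    \<comment> \<open>Expanding the constant function \<open>Y k0\<close> shows that the
      \<open>\<beta> t s\<close> sum to 1, so they cannot all be nonpositive.\<close>
    have "\<mu> > 0"
    proof (rule ccontr)
      assume "\<not> \<mu> > 0"
      then have "\<mu> * w t \<le> 0" if "t \<in> T" for t
        using pos[OF rep that] by (simp add: mult_le_0_iff)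
      then have "(\<Sum>t\<in>T. \<beta> t s) \<le> 0"
        using \<mu>_ge by (intro sum_nonpos) (meson order_trans)
      with expand[OF one(1), of s] one(2) show False by simp
    qed
    have \<beta>_i: "\<beta> i s = \<mu> * w i"
      using pos[OF rep i] by (simp add: \<mu>_def)
    have \<beta>_j: "\<beta> j s = \<mu> * w j"
      using pos[OF rep j(1)] by (simp add: \<mu>_j)
    \<comment> \<open>At a point of \<open>T\<close> only one \<open>\<beta>\<close> is nonzero,
      whereas those of \<open>i\<close> and \<open>j\<close> are both positive at
      \<open>s\<close>.\<close>
    have "s \<notin> T"
    proof
      assume "s \<in> T"
      have "\<mu> * w i > 0" "\<mu> * w j > 0"
        using \<open>\<mu> > 0\<close> pos[OF rep] i j by simp_all
      then have "\<beta> i s > 0" "\<beta> j s > 0"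
        by (simp_all add: \<beta>_i \<beta>_j)
      with \<beta>_T \<open>s \<in> T\<close> i j show False by (auto split: if_splits)
    qed
    \<comment> \<open>Weight \<open>1 / \<mu>\<close> at \<open>s\<close> is traded for the
      expansion of \<open>s\<close> over \<open>T\<close>. Since \<open>\<mu>\<close> is the largest
      ratio, no weight becomes negative, and those at \<open>i\<close> and \<open>j\<close> become
      zero.\<close>
    define w' where "w' = (\<lambda>t. w t - \<beta> t s / \<mu>)(s := 1 / \<mu>)"
    define T' where "T' = insert s (T - {i, j})"
    have w'_T: "w' t = w t - \<beta> t s / \<mu>" if "t \<in> T" for t
      using that \<open>s \<notin> T\<close> by (auto simp: w'_def)
    have "rep T' w'"
      unfolding rep_def
    proof (intro conjI ballI)
      show "finite T'" using finT by (simp add: T'_def)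
      show "0 \<le> w' t" if "t \<in> T'" for t
      proof (cases "t = s")
        case True
        then show ?thesis using \<open>\<mu> > 0\<close> by (simp add: w'_def)
      next
        case False
        with that have "t \<in> T" by (auto simp: T'_def)
        with \<mu>_ge[of t] \<open>\<mu> > 0\<close> show ?thesis
          by (simp add: w'_T pos_divide_le_eq mult.commute)
      qed
      fix k assume k: "k \<in> L"
      have "(\<Sum>t\<in>T'. w' t * Y k t) = Y k s / \<mu> + (\<Sum>t\<in>T - {i, j}. w' t * Y k t)"
        unfolding T'_def using finT \<open>s \<notin> T\<close> by (simp add: w'_def)
      also have "(\<Sum>t\<in>T - {i, j}. w' t * Y k t) = (\<Sum>t\<in>T. w' t * Y k t)"
        using finT i j \<beta>_i \<beta>_j \<open>\<mu> > 0\<close> by (intro sum.mono_neutral_left) (auto simp: w'_T)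
      also have "\<dots> = (\<Sum>t\<in>T. w t * Y k t - \<beta> t s * Y k t / \<mu>)"
        by (intro sum.cong) (auto simp: w'_T left_diff_distrib)
      also have "\<dots> = v k - Y k s / \<mu>"
        using rep k by (simp add: sum_subtractf rep_def expand[OF k, of s] sum_divide_distrib)
      finally show "v k = (\<Sum>t\<in>T'. w' t * Y k t)" by simp
    qed
    from min[OF this] have "card T \<le> Suc (card (T - {i, j}))"
      using finT by (simp add: T'_def card_insert_if split: if_splits)
    \<comment> \<open>Two points leave and one enters. The truncated subtraction is exact, as
      \<open>T\<close> has at least two points.\<close>
    moreover have "card (T - {i, j}) = card T - 2"
      using finT i j by (simp add: card_Diff_subset)
    ultimately show False
      using cardT L2 by linarith
  qed
  with rep show ?thesis unfolding rep_def by blast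
qed

section \<open>Consequences of the conditions and axioms\<close>

context expectation_quintuplet
begin

lemma F_Compl: "N \<in> \<F> \<Longrightarrow> - N \<in> \<F>"
  using algebra by (metis Compl_eq_Diff_UNIV algebra.compl_sets)

lemma F_UNIV: "UNIV \<in> \<F>"
  using algebra by (simp add: algebra.top)

lemma const_in: "(\<lambda>s. c) \<in> \<X>"
  using C1[OF C2[OF F_UNIV] C2[OF F_UNIV], of c 0] by simp

lemma E_lin: "Y1 \<in> \<X> \<Longrightarrow> Y2 \<in> \<X> \<Longrightarrow> E (\<lambda>s. a * Y1 s + b * Y2 s) = a * E Y1 + b * E Y2"
  using A2[of 2 "\<lambda>i. if i = 1 then Y1 else Y2" "\<lambda>i. if i = 1 then a else b"]
  by (simp add: numeral_2_eq_2)

lemma sum_in_E_sum: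
  assumes "finite K" "\<And>k. k \<in> K \<Longrightarrow> Y k \<in> \<X>"
  shows "(\<lambda>s. \<Sum>k\<in>K. a k * Y k s) \<in> \<X> \<and> E (\<lambda>s. \<Sum>k\<in>K. a k * Y k s) = (\<Sum>k\<in>K. a k * E (Y k))"
  using assms
proof (induction K rule: finite_induct)
  case empty
  then show ?case using const_in[of 0] A1[of 0] by simp
next
  case (insert j K)
  then show ?case
    using C1[of "Y j" "\<lambda>s. \<Sum>k\<in>K. a k * Y k s" "a j" 1] E_lin[of "Y j" "\<lambda>s. \<Sum>k\<in>K. a k * Y k s" "a j" 1]
    by simp
qed

lemma P_Compl:
  assumes "N \<in> \<F>"
  shows "P (- N) = 1 - P N"
proof -
  have "E (\<lambda>s. 1 * 1 + (-1) * indicat_real N s) = 1 * 1 + (-1) * P N"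
    using E_lin[OF const_in C2[OF assms], of 1 1 "-1"] A1[of 1] P_eq[OF assms] by simp
  moreover have "indicat_real (- N) = (\<lambda>s. 1 * 1 + (-1) * indicat_real N s)"
    by (auto simp: indicator_def)
  ultimately show ?thesis
    using P_eq[OF F_Compl[OF assms]] by simp
qed

lemma P_UNIV: "P UNIV = 1"
  using P_eq[OF F_UNIV] A1[of 1] by simp

text \<open>By C5, replacing \<open>Z\<close> by zero on the null set outside \<open>N\<close> keeps
  its expectation zero. The new function is nonnegative everywhere, so A3 leaves only the
  alternative that it vanishes with probability 1.\<close>

lemma P_zero_set_eq_1:
  assumes N: "N \<in> \<F>" "P N = 1" and Z: "Z \<in> \<X>" "E Z = 0" and nonneg: "\<And>s. s \<in> N \<Longrightarrow> 0 \<le> Z s"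
  shows "{s \<in> N. Z s = 0} \<in> \<F> \<and> P {s \<in> N. Z s = 0} = 1"
proof -
  define Z' where "Z' = (\<lambda>s. 1 * Z s + (-1) * (Z s * indicat_real (- N) s))"
  have c5: "(\<lambda>s. Z s * indicat_real (- N) s) \<in> \<X>" "E (\<lambda>s. Z s * indicat_real (- N) s) = 0"
    using C5[OF Z(1) F_Compl[OF N(1)]] P_Compl[OF N(1)] N(2) by auto
  have Z'_in: "Z' \<in> \<X>"
    unfolding Z'_def by (rule C1[OF Z(1) c5(1)])
  have "E Z' = 0"
    unfolding Z'_def by (subst E_lin[OF Z(1) c5(1)]) (simp add: Z c5)
  have Z'_eq: "Z' s = (if s \<in> N then Z s else 0)" for s
    by (simp add: Z'_def)
  have "0 \<le> Z' s" for s
    using nonneg by (simp add: Z'_eq)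
  then have "\<not> (\<exists>s1 s2. Z' s1 * Z' s2 < 0)"
    by (simp add: not_less)
  define M where "M = {s. Z' s = 0}"
  have PM: "P M = 1"
    using A3[OF Z'_in \<open>E Z' = 0\<close>] \<open>\<not> (\<exists>s1 s2. Z' s1 * Z' s2 < 0)\<close> by (simp add: M_def)
  have MF: "M \<in> \<F>"
    using C3[OF Z'_in, of "{0}"] by (simp add: M_def is_interval_1)
  have eq: "{s \<in> N. Z s = 0} = M \<inter> N" and cover: "M \<union> N = UNIV"
    by (auto simp: M_def Z'_eq)
  have inF: "M \<inter> N \<in> \<F>"
    using algebra MF N(1) by (simp add: algebra_iff_Int)
  \<comment> \<open>Inclusion-exclusion: \<open>M\<close> and \<open>N\<close> cover the space, so
    \<open>P (M \<inter> N) = P M + P N - 1\<close>.\<close>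
  have "indicat_real (M \<inter> N) = (\<lambda>s. 1 * (1 * indicat_real M s + 1 * indicat_real N s) + (-1) * 1)"
    using cover by (intro ext) (auto simp: indicator_def)
  then have "E (indicat_real (M \<inter> N)) = 1 * (1 * P M + 1 * P N) + (-1) * 1"
    using E_lin[OF C1[OF C2[OF MF] C2[OF N(1)], of 1 1] const_in[of 1], of 1 "-1"]
      E_lin[OF C2[OF MF] C2[OF N(1)], of 1 1] A1[of 1] P_eq[OF MF] P_eq[OF N(1)] by simp
  then show ?thesis
    using P_eq[OF inF] PM N(2) inF by (simp add: eq)
qed

section \<open>The vector of expectations as a convex combination\<close>

text \<open>
  If the vector of expectations were not in the convex hull, a separating hyperplane would give a
  linear relation that holds almost surely; it expresses one of the functions through the others
  on a smaller set of probability 1.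
\<close>

lemma expectation_in_convex_hull:
  assumes "finite K" "\<And>k. k \<in> K \<Longrightarrow> Y k \<in> \<X>" "N \<in> \<F>" "P N = 1"
  shows "\<exists>T w. finite T \<and> T \<subseteq> N \<and> (\<forall>t\<in>T. 0 \<le> w t) \<and> sum w T = 1 \<and>
           (\<forall>k\<in>K. E (Y k) = (\<Sum>t\<in>T. w t * Y k t))"
  using assms
proof (induction K arbitrary: N rule: finite_psubset_induct)
  case (psubset K N)
  note N = psubset.prems(2,3) and Y = psubset.prems(1)
  \<comment> \<open>Weights are finitely supported functions on the whole space, so that mixing them
    is pointwise. Centring \<open>pt\<close> at the expectations turns the claim into the presence
    of the origin among the \<open>pt w\<close>.\<close>
  define conv where "conv w \<longleftrightarrow> finite {t. w t \<noteq> 0} \<and> {t. w t \<noteq> 0} \<subseteq> N \<and> (\<forall>t. 0 \<le> w t) \<and>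
    sum w {t. w t \<noteq> 0} = 1" for w :: "'a \<Rightarrow> real"
  define pt where "pt w k = (\<Sum>t | w t \<noteq> 0. w t * Y k t) - E (Y k)" for w k
  show ?case
  proof (cases "\<exists>w. conv w \<and> (\<forall>k\<in>K. pt w k = 0)")
    case True
    then obtain w where "conv w" "\<forall>k\<in>K. pt w k = 0" by blast
    then show ?thesis
      by (intro exI[of _ "{t. w t \<noteq> 0}"] exI[of _ w]) (simp add: conv_def pt_def)
  next
    case False
    have "N \<noteq> {}"
      using N P_Compl[OF F_UNIV] P_UNIV by auto
    have conv_single: "conv (\<lambda>t. if t = s then 1 else 0)" if "s \<in> N" for s
      using that by (simp add: conv_def)
    have pt_single: "pt (\<lambda>t. if t = s then 1 else 0) k = Y k s - E (Y k)" for s k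
      by (simp add: pt_def)
    have conv_mix: "conv (\<lambda>t. (1 - u) * w t + u * w' t)"
      "pt (\<lambda>t. (1 - u) * w t + u * w' t) k = (1 - u) * pt w k + u * pt w' k"
      if w: "conv w" "conv w'" "0 \<le> u" "u \<le> 1" for w w' u k
    proof -
      define T where "T = {t. w t \<noteq> 0} \<union> {t. w' t \<noteq> 0}"
      have T: "finite T" "T \<subseteq> N" using w by (auto simp: T_def conv_def)
      let ?m = "\<lambda>t. (1 - u) * w t + u * w' t"
      have sub: "{t. ?m t \<noteq> 0} \<subseteq> T" "{t. w t \<noteq> 0} \<subseteq> T" "{t. w' t \<noteq> 0} \<subseteq> T"
        by (auto simp: T_def)
      \<comment> \<open>The supports of the two weights and of their mixture may differ; all three
        sums are moved to the common finite set \<open>T\<close>.\<close>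
      have supp: "(\<Sum>t | z t \<noteq> 0. z t * g t) = (\<Sum>t\<in>T. z t * g t)" if "{t. z t \<noteq> 0} \<subseteq> T"
        for z g :: "'a \<Rightarrow> real"
        using that T by (intro sum.mono_neutral_left) auto
      have mix: "(\<Sum>t | ?m t \<noteq> 0. ?m t * g t) =
          (1 - u) * (\<Sum>t | w t \<noteq> 0. w t * g t) + u * (\<Sum>t | w' t \<noteq> 0. w' t * g t)" for g
        unfolding sub[THEN supp] by (simp add: distrib_right sum.distrib sum_distrib_left mult.assoc)
      show "conv ?m"
        using w T sub mix[of "\<lambda>_. 1"] by (auto simp: conv_def intro: finite_subset)
      show "pt ?m k = (1 - u) * pt w k + u * pt w' k"
        unfolding pt_def mix by (simp add: algebra_simps)
    qed
    define C where "C = pt ` {w. conv w}"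
    have "\<exists>a. (\<forall>x\<in>C. 0 \<le> (\<Sum>k\<in>K. a k * x k)) \<and> (\<exists>x\<in>C. 0 < (\<Sum>k\<in>K. a k * x k))"
    proof (rule proper_separation[OF psubset.hyps])
      show "C \<noteq> {}" using \<open>N \<noteq> {}\<close> conv_single by (auto simp: C_def)
      show "(\<lambda>k. (1 - u) * x k + u * y k) \<in> C" if "x \<in> C" "y \<in> C" "0 \<le> u" "u \<le> 1" for x y u
      proof -
        from that obtain w w' where "conv w" "conv w'" "x = pt w" "y = pt w'"
          by (auto simp: C_def)
        then have "(\<lambda>k. (1 - u) * x k + u * y k) = pt (\<lambda>t. (1 - u) * w t + u * w' t)"
          using conv_mix(2) that(3,4) by (intro ext) simp
        with conv_mix(1) \<open>conv w\<close> \<open>conv w'\<close> that(3,4) show ?thesis by (auto simp: C_def)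
      qed
      show "\<exists>k\<in>K. x k \<noteq> 0" if "x \<in> C" for x
        using that False by (auto simp: C_def)
    qed
    then obtain a where a: "\<And>w. conv w \<Longrightarrow> 0 \<le> (\<Sum>k\<in>K. a k * pt w k)"
      and a_pos: "\<exists>w. 0 < (\<Sum>k\<in>K. a k * pt w k)"
      by (auto simp: C_def)
    define e where "e = (\<Sum>k\<in>K. a k * E (Y k))"
    define Z where "Z = (\<lambda>s. 1 * (\<Sum>k\<in>K. a k * Y k s) + (-1) * e)"
    have S: "(\<lambda>s. \<Sum>k\<in>K. a k * Y k s) \<in> \<X>" "E (\<lambda>s. \<Sum>k\<in>K. a k * Y k s) = e"
      using sum_in_E_sum[OF psubset.hyps Y, where a = a] by (auto simp: e_def)
    have "Z \<in> \<X>" "E Z = 0"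
      using C1[OF S(1) const_in[of e], of 1 "-1"] E_lin[OF S(1) const_in[of e], of 1 "-1"] A1[of e] S(2)
      by (simp_all add: Z_def)
    \<comment> \<open>At the point mass in \<open>s\<close> the separating functional takes the
      value \<open>Z s\<close>.\<close>
    moreover have "0 \<le> Z s" if "s \<in> N" for s
      using a[OF conv_single[OF that]]
      by (simp add: pt_single Z_def e_def right_diff_distrib sum_subtractf)
    ultimately have N': "{s \<in> N. Z s = 0} \<in> \<F>" "P {s \<in> N. Z s = 0} = 1"
      using P_zero_set_eq_1[OF N] by auto
    \<comment> \<open>The strict inequality of the separation excludes the zero functional.\<close>
    have "\<exists>j\<in>K. a j \<noteq> 0"
    proof (rule ccontr)
      assume "\<not> (\<exists>j\<in>K. a j \<noteq> 0)"
      with a_pos show False by simp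
    qed
    then obtain j where j: "j \<in> K" "a j \<noteq> 0" by blast
    have "K - {j} \<subset> K" using j by auto
    then obtain T w where T: "finite T" "T \<subseteq> {s \<in> N. Z s = 0}" "\<forall>t\<in>T. 0 \<le> w t" "sum w T = 1"
      and others: "\<And>k. k \<in> K - {j} \<Longrightarrow> E (Y k) = (\<Sum>t\<in>T. w t * Y k t)"
      using psubset.IH[of "K - {j}", OF _ _ N'] Y by blast
    \<comment> \<open>Averaging the relation \<open>Z = 0\<close> over \<open>T\<close> and
      comparing it with the same relation between expectations determines the term of
      \<open>j\<close>, because \<open>a j \<noteq> 0\<close>.\<close>
    have "E (Y j) = (\<Sum>t\<in>T. w t * Y j t)"
    proof -
      have split: "(\<Sum>k\<in>K. a k * g k) = a j * g j + (\<Sum>k\<in>K - {j}. a k * g k)" for g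
        using j psubset.hyps by (simp add: sum.remove)
      have "e = (\<Sum>t\<in>T. w t * e)"
        using T(4) by (simp add: sum_distrib_right[symmetric])
      also have "\<dots> = (\<Sum>t\<in>T. w t * (\<Sum>k\<in>K. a k * Y k t))"
        using T(2) by (intro sum.cong) (auto simp: Z_def)
      also have "\<dots> = (\<Sum>k\<in>K. a k * (\<Sum>t\<in>T. w t * Y k t))"
        unfolding sum_distrib_left by (subst sum.swap) (simp add: mult_ac)
      also have "\<dots> = a j * (\<Sum>t\<in>T. w t * Y j t) + (\<Sum>k\<in>K - {j}. a k * E (Y k))"
        unfolding split using others by simp
      finally have "a j * E (Y j) = a j * (\<Sum>t\<in>T. w t * Y j t)"
        unfolding e_def split by simp
      with j show ?thesis by simp
    qed
    with others have "\<forall>k\<in>K. E (Y k) = (\<Sum>t\<in>T. w t * Y k t)" by blast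
    with T show ?thesis by blast
  qed
qed

end

section \<open>Representation by \<open>n\<close> points\<close>

theorem theorem3p3:
  fixes \<F> :: "'a::topological_space set set"
    and \<X> :: "('a \<Rightarrow> real) set"
    and E :: "('a \<Rightarrow> real) \<Rightarrow> real"
    and P :: "'a set \<Rightarrow> real"
    and X :: "nat \<Rightarrow> 'a \<Rightarrow> real"
    and n :: nat
  assumes "expectation_quintuplet \<F> \<X> E P"
    and "path_connected (UNIV :: 'a set)"
    and "n \<ge> 1"
    and "\<And>k. k \<in> {1..n} \<Longrightarrow> X k \<in> \<X>"
    and "\<And>k. k \<in> {1..n} \<Longrightarrow> continuous_on UNIV (X k)"
  shows "\<exists>(t :: nat \<Rightarrow> 'a) (w :: nat \<Rightarrow> real).
           (\<forall>i\<in>{1..n}. w i \<ge> 0) \<and> (\<Sum>i=1..n. w i) = 1 \<and>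
           (\<forall>k\<in>{1..n}. E (X k) = (\<Sum>i=1..n. w i * X k (t i)))"
proof -
  interpret expectation_quintuplet \<F> \<X> E P by (fact assms(1))
  obtain T0 w0 where T0: "finite T0" "\<forall>t\<in>T0. 0 \<le> w0 t" "sum w0 T0 = 1"
    "\<forall>k\<in>{1..n}. E (X k) = (\<Sum>t\<in>T0. w0 t * X k t)"
    using expectation_in_convex_hull[of "{1..n}" X UNIV] assms(4) F_UNIV P_UNIV by auto
  \<comment> \<open>The constant function at index 0 makes the normalisation one more equation.
    There are then \<open>n + 1\<close> functions, and fewer than \<open>n + 1\<close> points
    suffice.\<close>
  define Y where "Y = X(0 := \<lambda>_. 1)"
  define v where "v = (\<lambda>k. E (X k))(0 := 1)"
  have "\<exists>T w. finite T \<and> card T < card {0..n} \<and> (\<forall>t\<in>T. 0 \<le> w t) \<and>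
      (\<forall>k\<in>{0..n}. v k = (\<Sum>t\<in>T. w t * Y k t))"
  proof (rule caratheodory_fenchel[where ?k0.0=0 and ?T0.0=T0 and ?w0.0=w0])
    show "connected (UNIV :: 'a set)"
      using assms(2) by (rule path_connected_imp_connected)
    show "continuous_on UNIV (Y k)" if "k \<in> {0..n}" for k
      using that assms(5)[of k] by (cases "k = 0") (auto simp: Y_def)
    show "v k = (\<Sum>t\<in>T0. w0 t * Y k t)" if "k \<in> {0..n}" for k
      using that T0(3,4) by (cases "k = 0") (auto simp: Y_def v_def)
  qed (use assms(3) T0 in \<open>auto simp: Y_def\<close>)
  then obtain T w where T: "finite T" "card T \<le> n" "\<And>t. t \<in> T \<Longrightarrow> 0 \<le> w t"
    and rep: "\<And>k. k \<in> {0..n} \<Longrightarrow> v k = (\<Sum>t\<in>T. w t * Y k t)"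
    by (metis card_atLeastAtMost diff_zero less_Suc_eq_le)
  obtain h where h: "bij_betw h {1..card T} T"
    using ex_bij_betw_nat_finite_1[OF T(1)] by blast
  \<comment> \<open>Indices beyond \<open>card T\<close> get weight 0, so the unspecified points
    \<open>h i\<close> there do not contribute.\<close>
  define u where "u i = (if i \<le> card T then w (h i) else 0)" for i
  have sum_u: "(\<Sum>i=1..n. u i * g (h i)) = (\<Sum>t\<in>T. w t * g t)" for g
  proof -
    have "(\<Sum>i=1..n. u i * g (h i)) = (\<Sum>i=1..card T. u i * g (h i))"
      using T(2) by (intro sum.mono_neutral_right) (auto simp: u_def)
    also have "\<dots> = (\<Sum>i=1..card T. w (h i) * g (h i))"
      by (intro sum.cong) (auto simp: u_def)
    finally show ?thesis
      using sum.reindex_bij_betw[OF h, of "\<lambda>t. w t * g t"] by simp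
  qed
  have "\<forall>i\<in>{1..n}. u i \<ge> 0"
    using T(3) bij_betwE[OF h] by (auto simp: u_def)
  moreover have "(\<Sum>i=1..n. u i) = 1"
    using sum_u[of "\<lambda>_. 1"] rep[of 0] by (simp add: v_def Y_def)
  moreover have "\<forall>k\<in>{1..n}. E (X k) = (\<Sum>i=1..n. u i * X k (h i))"
  proof
    fix k assume "k \<in> {1..n}"
    then show "E (X k) = (\<Sum>i=1..n. u i * X k (h i))"
      using sum_u[of "X k"] rep[of k] by (simp add: v_def Y_def)
  qed
  ultimately show ?thesis by blast
qed

end
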